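(* Let $h_M,h_E$ be independent nonnegative random variables with bounded continuous densities $f(h_M)$ and $f(h_E)$ on $[0,\infty)$, and let $\bar P>0$. Consider the problem of maximizing $$\iint\Big[\log\big(1+h_MP(h_M)\big)-\log\big(1+h_EP(h_M)\big)\Big]^+f(h_M)f(h_E)\,dh_M\,dh_E$$ over all power allocation policies $P:[0,\infty)\to[0,\infty)$ with $\mathbb E\{P(h_M)\}\le\bar P$ (the maximum is the secrecy capacity with only main channel CSI at the transmitter). The optimal policy is as follows: for each $h_M$, $P(h_M)$ is the solution of $$\frac{h_M\Pr(h_E\le h_M)}{1+h_MP(h_M)}-\int_0^{h_M}\frac{h_E}{1+h_EP(h_M)}f(h_E)\,dh_E-\lambda=0$$ if this equation has a positive solution, and $P(h_M)=0$ otherwise, where $\lambda>0$ is a constant such that $\mathbb E\{P(h_M)\}=\bar P$. (In $\Pr(h_E\le h_M)$ the value $h_M$ is fixed and the probability is over $h_E$.)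
   Context: $h_M$ and $h_E$ are the fading power gains of the main channel and of the eavesdropper channel; the two densities may differ, the argument indicating which is meant. $[x]^+=\max\{0,x\}$. Here $\log$ is the natural logarithm (changing the base only rescales the objective).
   Formalization: Existence of λ with E{P(h_M)}=P̄ is claimed only if Pr(h_E<h_M)>0 (otherwise the described P is 0 almost surely and no λ exists); uniqueness of the optimal policy is claimed almost surely and only when the maximum is finite (otherwise P/2 is also optimal). *)

theory Defs
  imports "HOL-Probability.Probability"
begin

text \<open>
  Channel gains live on the half line \<open>[0, \<infinity>)\<close>, so densities and power policies are functions
  \<open>real \<Rightarrow> real\<close> of which only the values on \<open>{0..}\<close> matter.
\<close>

definition has_gain_density :: "'a measure \<Rightarrow> ('a \<Rightarrow> real) \<Rightarrow> (real \<Rightarrow> real) \<Rightarrow> bool" where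
  "has_gain_density \<Omega> h f \<longleftrightarrow>
     (\<forall>x\<ge>0. 0 \<le> f x) \<and> continuous_on {0..} f \<and> bounded (f ` {0..}) \<and>
     distributed \<Omega> lborel h (\<lambda>x. ennreal (indicator {0..} x * f x))"

text \<open>
  The integrands below are nonnegative, so expectations and the objective are taken in \<open>[0, \<infinity>]\<close>.
  The objective may indeed be infinite, since no moment of the main channel gain is assumed finite.
\<close>

definition secrecy_objective ::
    "(real \<Rightarrow> real) \<Rightarrow> (real \<Rightarrow> real) \<Rightarrow> (real \<Rightarrow> real) \<Rightarrow> ennreal" where
  "secrecy_objective fM fE P =
     (\<integral>\<^sup>+x\<in>{0..}. (\<integral>\<^sup>+y\<in>{0..}.
        ennreal (max 0 (ln (1 + x * P x) - ln (1 + y * P x)) * fM x * fE y) \<partial>lborel) \<partial>lborel)"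

definition average_power :: "'a measure \<Rightarrow> ('a \<Rightarrow> real) \<Rightarrow> (real \<Rightarrow> real) \<Rightarrow> ennreal" where
  "average_power \<Omega> hM P = (\<integral>\<^sup>+\<omega>. ennreal (P (hM \<omega>)) \<partial>\<Omega>)"

definition feasible_policy ::
    "'a measure \<Rightarrow> ('a \<Rightarrow> real) \<Rightarrow> real \<Rightarrow> (real \<Rightarrow> real) \<Rightarrow> bool" where
  "feasible_policy \<Omega> hM Pbar P \<longleftrightarrow>
     set_borel_measurable borel {0..} P \<and> (\<forall>x\<ge>0. 0 \<le> P x) \<and>
     average_power \<Omega> hM P \<le> ennreal Pbar"

definition optimal_policy ::
    "'a measure \<Rightarrow> ('a \<Rightarrow> real) \<Rightarrow> (real \<Rightarrow> real) \<Rightarrow> (real \<Rightarrow> real) \<Rightarrow> real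
      \<Rightarrow> (real \<Rightarrow> real) \<Rightarrow> bool" where
  "optimal_policy \<Omega> hM fM fE Pbar P \<longleftrightarrow>
     is_arg_max (secrecy_objective fM fE) (feasible_policy \<Omega> hM Pbar) P"

definition power_equation ::
    "'a measure \<Rightarrow> ('a \<Rightarrow> real) \<Rightarrow> (real \<Rightarrow> real) \<Rightarrow> real \<Rightarrow> real \<Rightarrow> real \<Rightarrow> bool" where
  "power_equation \<Omega> hE fE lam x p \<longleftrightarrow>
     x * \<P>(\<omega> in \<Omega>. hE \<omega> \<le> x) / (1 + x * p)
       - (LBINT y:{0..x}. y / (1 + y * p) * fE y) - lam = 0"

definition solves_power_equation ::
    "'a measure \<Rightarrow> ('a \<Rightarrow> real) \<Rightarrow> (real \<Rightarrow> real) \<Rightarrow> real \<Rightarrow> (real \<Rightarrow> real) \<Rightarrow> bool" where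
  "solves_power_equation \<Omega> hE fE lam P \<longleftrightarrow>
     (\<forall>x\<ge>0. if \<exists>p>0. power_equation \<Omega> hE fE lam x p
             then P x > 0 \<and> power_equation \<Omega> hE fE lam x (P x)
             else P x = 0)"

end

theory Submission
  imports Defs
begin

text \<open>
  Given \<open>h\<^sub>M = x\<close>, spending power \<open>p\<close> yields a rate \<open>secrecy_rate x p\<close> that is concave in \<open>p\<close> with
  derivative \<open>marginal_rate x p\<close>, the integral over \<open>y \<in> [0, x]\<close>, against the law of \<open>h\<^sub>E\<close>, of
  \<open>x / (1 + x p) - y / (1 + y p) = (x - y) / ((1 + x p) (1 + y p))\<close>. The power equation says that
  this derivative equals \<open>lam\<close>, so its solution maximizes \<open>secrecy_rate x p - lam * p\<close>
  over \<open>p \<ge> 0\<close>, and integrating over \<open>x\<close> gives optimality under the average power constraint.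
  Comparing kernels for \<open>p \<le> q\<close> shows that \<open>(1 + x p) * marginal_rate x p\<close> decreases and
  \<open>(1 + x p)\<^sup>2 * marginal_rate x p\<close> increases in \<open>p\<close>. From these two monotonicities follow
  uniqueness of the solution, its Lipschitz dependence on \<open>lam\<close>, and enough growth as
  \<open>lam \<rightarrow> 0\<close> for the intermediate value theorem to find the multiplier.
\<close>

section \<open>Pointwise inequalities for the two integrands\<close>

lemma marginal_kernel_eq:
  fixes x y p :: real
  assumes "0 \<le> y" "y \<le> x" "0 \<le> p"
  shows "x / (1 + x * p) - y / (1 + y * p) = (x - y) / ((1 + x * p) * (1 + y * p))"
proof -
  have "1 + x * p > 0" "1 + y * p > 0" using assms by (auto intro: add_pos_nonneg)
  then show ?thesis by (simp add: field_simps)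
qed

text \<open>This is the tangent inequality for the concave function
  \<open>ln ((1 + x * p) / (1 + y * p))\<close> of \<open>p\<close>, obtained without calculus:
  \<open>ln u \<le> u - 1\<close> is applied to the quotient \<open>u\<close> of the ratios at
  \<open>q\<close> and \<open>p\<close>. Replacing \<open>1 + y * q\<close> by
  \<open>1 + y * p\<close> in the resulting bound goes the right way for either sign of
  \<open>q - p\<close>.\<close>

lemma ln_ratio_diff_le:
  fixes x y p q :: real
  assumes "0 \<le> y" "y \<le> x" "0 \<le> p" "0 \<le> q"
  shows "(ln (1 + x * q) - ln (1 + y * q)) - (ln (1 + x * p) - ln (1 + y * p))
    \<le> (x / (1 + x * p) - y / (1 + y * p)) * (q - p)"
proof -
  have pos: "1 + x * p > 0" "1 + y * p > 0" "1 + x * q > 0" "1 + y * q > 0"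
    using assms by (auto intro: add_pos_nonneg)
  define u where "u = ((1 + x * q) * (1 + y * p)) / ((1 + x * p) * (1 + y * q))"
  have "u > 0" unfolding u_def using pos by simp
  have "(ln (1 + x * q) - ln (1 + y * q)) - (ln (1 + x * p) - ln (1 + y * p)) = ln u"
    unfolding u_def using pos by (simp add: ln_div ln_mult)
  also have "\<dots> \<le> u - 1" using \<open>u > 0\<close> by (rule ln_le_minus_one)
  also have "u - 1 = (x - y) / (1 + x * p) * ((q - p) / (1 + y * q))"
    unfolding u_def using pos by (simp add: divide_simps) (simp add: algebra_simps)
  also have "\<dots> \<le> (x - y) / (1 + x * p) * ((q - p) / (1 + y * p))"
  proof (rule mult_left_mono)
    show "(q - p) / (1 + y * q) \<le> (q - p) / (1 + y * p)"
    proof (cases "p \<le> q")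
      case True
      with assms have "y * p \<le> y * q" by (intro mult_left_mono) auto
      then show ?thesis using pos True by (intro divide_left_mono) auto
    next
      case False
      with assms have "y * q \<le> y * p" by (intro mult_left_mono) auto
      then show ?thesis using pos False by (intro divide_left_mono_neg) auto
    qed
  qed (use assms pos in auto)
  also have "\<dots> = (x / (1 + x * p) - y / (1 + y * p)) * (q - p)"
    unfolding marginal_kernel_eq[OF assms(1-3)] by simp
  finally show ?thesis .
qed

section \<open>Rates at a fixed main gain \<open>x\<close>, with \<open>M\<close> as the law of the
  eavesdropper gain\<close>

context real_distribution
begin

text \<open>Integrating only over \<open>{0..x}\<close> accounts for the positive part in the
  objective: an eavesdropper gain above \<open>x\<close> contributes nothing.\<close>

definition marginal_rate :: "real \<Rightarrow> real \<Rightarrow> real" where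
  "marginal_rate x p = (LINT y:{0..x}|M. x / (1 + x * p) - y / (1 + y * p))"

definition secrecy_rate :: "real \<Rightarrow> real \<Rightarrow> real" where
  "secrecy_rate x p = (LINT y:{0..x}|M. ln (1 + x * p) - ln (1 + y * p))"

lemma set_integrable_of_bounds:
  fixes g :: "real \<Rightarrow> real"
  assumes "g \<in> borel_measurable borel" "\<And>y. y \<in> {0..x} \<Longrightarrow> 0 \<le> g y \<and> g y \<le> B"
  shows "set_integrable M {0..x} g"
  unfolding set_integrable_def
\<comment> \<open>For \<open>x < 0\<close> the interval is empty and \<open>B\<close> may be
  negative, so \<open>max 0 B\<close> is the bound that always works.\<close>
proof (rule integrable_const_bound[where B = "max 0 B"])
  show "AE y in M. norm (indicat_real {0..x} y *\<^sub>R g y) \<le> max 0 B"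
    using assms(2) by (auto simp: indicator_def max_def intro!: AE_I2) (smt (verit))+
qed (use assms(1) in measurable)

lemma set_integral_le_bound:
  fixes g :: "real \<Rightarrow> real"
  assumes "g \<in> borel_measurable borel" "\<And>y. y \<in> {0..x} \<Longrightarrow> 0 \<le> g y \<and> g y \<le> B" "0 \<le> B"
  shows "(LINT y:{0..x}|M. g y) \<le> B"
proof -
  have "(LINT y:{0..x}|M. g y) \<le> (LINT y|M. B)"
    unfolding set_lebesgue_integral_def
    using set_integrable_of_bounds[OF assms(1,2)] assms(2,3)
    by (intro integral_mono) (auto simp: set_integrable_def indicator_def)
  then show ?thesis using prob_space by simp
qed

lemma marginal_kernel_bounds:
  fixes x y p :: real
  assumes "y \<in> {0..x}" "0 \<le> p"
  shows "0 \<le> x / (1 + x * p) - y / (1 + y * p) \<and> x / (1 + x * p) - y / (1 + y * p) \<le> x / (1 + x * p)"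
proof -
  have "1 + x * p > 0" "1 + y * p > 0" using assms by (auto intro: add_pos_nonneg)
  moreover have "0 \<le> x / (1 + x * p) - y / (1 + y * p)"
    using assms calculation by (subst marginal_kernel_eq) auto
  ultimately show ?thesis using assms by auto
qed

lemma set_integrable_marginal:
  assumes "0 \<le> p"
  shows "set_integrable M {0..x} (\<lambda>y. x / (1 + x * p) - y / (1 + y * p))"
  by (rule set_integrable_of_bounds[OF _ marginal_kernel_bounds]) (use assms in auto)

lemma rate_kernel_bounds:
  fixes x y p :: real
  assumes "y \<in> {0..x}" "0 \<le> p"
  shows "0 \<le> ln (1 + x * p) - ln (1 + y * p) \<and> ln (1 + x * p) - ln (1 + y * p) \<le> ln (1 + x * p)"
proof -
  have "y * p \<le> x * p" "0 \<le> y * p" using assms by (auto intro: mult_right_mono)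
  then show ?thesis by auto
qed

lemma set_integrable_rate:
  assumes "0 \<le> p"
  shows "set_integrable M {0..x} (\<lambda>y. ln (1 + x * p) - ln (1 + y * p))"
  by (rule set_integrable_of_bounds[OF _ rate_kernel_bounds]) (use assms in auto)

lemma marginal_rate_nonneg: "0 \<le> p \<Longrightarrow> 0 \<le> marginal_rate x p"
  unfolding marginal_rate_def set_lebesgue_integral_def
  by (intro Bochner_Integration.integral_nonneg) (use marginal_kernel_bounds in \<open>auto simp: indicator_def\<close>)

lemma secrecy_rate_nonneg: "0 \<le> p \<Longrightarrow> 0 \<le> secrecy_rate x p"
  unfolding secrecy_rate_def set_lebesgue_integral_def
  by (intro Bochner_Integration.integral_nonneg) (use rate_kernel_bounds in \<open>auto simp: indicator_def\<close>)

lemma marginal_rate_le: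
  assumes "0 \<le> x" "0 \<le> p"
  shows "marginal_rate x p \<le> x / (1 + x * p)"
  unfolding marginal_rate_def
  by (rule set_integral_le_bound[OF _ marginal_kernel_bounds]) (use assms in auto)

lemma marginal_rate_le_gain:
  assumes "0 \<le> x" "0 \<le> p"
  shows "marginal_rate x p \<le> x"
proof -
  have "x / (1 + x * p) \<le> x / 1" using assms by (intro divide_left_mono) (auto intro: add_pos_nonneg)
  with marginal_rate_le[OF assms] show ?thesis by simp
qed

text \<open>For each \<open>y\<close>, the kernel times \<open>1 + x * p\<close> is
  \<open>(x - y) / (1 + y * p)\<close>, which decreases in \<open>p\<close>.\<close>

lemma marginal_rate_upper_scaling:
  assumes "0 \<le> x" "0 \<le> p" "p \<le> q"
  shows "marginal_rate x q \<le> (1 + x * p) / (1 + x * q) * marginal_rate x p"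
proof -
  have "marginal_rate x q \<le> (LINT y:{0..x}|M. (1 + x * p) / (1 + x * q) * (x / (1 + x * p) - y / (1 + y * p)))"
    unfolding marginal_rate_def
  proof (rule set_integral_mono)
    fix y assume y: "y \<in> {0..x}"
    have pos: "1 + x * p > 0" "1 + y * p > 0" "1 + x * q > 0" "1 + y * q > 0"
      using assms y by (auto intro: add_pos_nonneg)
    have "1 + y * p \<le> 1 + y * q" using assms y by (auto intro: mult_left_mono)
    have "x / (1 + x * q) - y / (1 + y * q) = (x - y) / ((1 + x * q) * (1 + y * q))"
      using assms y by (subst marginal_kernel_eq) auto
    also have "\<dots> \<le> (x - y) / ((1 + x * q) * (1 + y * p))"
      using \<open>1 + y * p \<le> 1 + y * q\<close> pos y by (intro divide_left_mono mult_left_mono) auto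
    also have "\<dots> = (1 + x * p) / (1 + x * q) * (x / (1 + x * p) - y / (1 + y * p))"
      using assms y pos by (subst marginal_kernel_eq) auto
    finally show "x / (1 + x * q) - y / (1 + y * q)
      \<le> (1 + x * p) / (1 + x * q) * (x / (1 + x * p) - y / (1 + y * p))" .
  qed (use assms set_integrable_marginal in auto)
  then show ?thesis by (simp add: marginal_rate_def)
qed

text \<open>For each \<open>y\<close>, the kernel times the square of \<open>1 + x * p\<close> is
  \<open>(x - y) * ((1 + x * p) / (1 + y * p))\<close>, which increases in \<open>p\<close> because
  \<open>y \<le> x\<close>.\<close>

lemma marginal_rate_lower_scaling:
  assumes "0 \<le> x" "0 \<le> p" "p \<le> q"
  shows "((1 + x * p) / (1 + x * q))\<^sup>2 * marginal_rate x p \<le> marginal_rate x q"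
proof -
  have "(LINT y:{0..x}|M. ((1 + x * p) / (1 + x * q))\<^sup>2 * (x / (1 + x * p) - y / (1 + y * p))) \<le> marginal_rate x q"
    unfolding marginal_rate_def
  proof (rule set_integral_mono)
    fix y assume y: "y \<in> {0..x}"
    have pos: "1 + x * p > 0" "1 + y * p > 0" "1 + x * q > 0" "1 + y * q > 0"
      using assms y by (auto intro: add_pos_nonneg)
    have "x * (q - p) \<ge> y * (q - p)" using assms y by (intro mult_right_mono) auto
    then have le: "(1 + x * p) * (1 + y * q) \<le> (1 + x * q) * (1 + y * p)"
      by (simp add: algebra_simps)
    have "((1 + x * p) / (1 + x * q))\<^sup>2 * (x / (1 + x * p) - y / (1 + y * p))
      = (x - y) / (1 + x * q) * ((1 + x * p) / ((1 + x * q) * (1 + y * p)))"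
      using assms y pos by (subst marginal_kernel_eq) (auto simp: power2_eq_square)
    also have "\<dots> \<le> (x - y) / (1 + x * q) * (1 / (1 + y * q))"
      using le pos y by (intro mult_left_mono) (auto simp: divide_simps)
    also have "\<dots> = x / (1 + x * q) - y / (1 + y * q)"
      using assms y by (subst marginal_kernel_eq) auto
    finally show "((1 + x * p) / (1 + x * q))\<^sup>2 * (x / (1 + x * p) - y / (1 + y * p))
      \<le> x / (1 + x * q) - y / (1 + y * q)" .
  qed (use assms set_integrable_marginal in auto)
  then show ?thesis by (simp add: marginal_rate_def)
qed

lemma marginal_rate_antimono:
  assumes "0 \<le> x" "0 \<le> p" "p \<le> q"
  shows "marginal_rate x q \<le> marginal_rate x p"
proof -
  have "(1 + x * p) / (1 + x * q) \<le> 1"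
    using assms by (auto simp: divide_le_eq_1 intro!: mult_left_mono add_pos_nonneg)
  then have "(1 + x * p) / (1 + x * q) * marginal_rate x p \<le> 1 * marginal_rate x p"
    using marginal_rate_nonneg assms by (intro mult_right_mono) auto
  with marginal_rate_upper_scaling[OF assms] show ?thesis by simp
qed

text \<open>A positive marginal rate forces \<open>x > 0\<close>, and then the factor in
  \<open>marginal_rate_upper_scaling\<close> is strictly below 1.\<close>

lemma marginal_rate_strict_antimono:
  assumes "0 \<le> x" "0 \<le> p" "p < q" "0 < marginal_rate x p"
  shows "marginal_rate x q < marginal_rate x p"
proof -
  have "x > 0" using marginal_rate_le_gain[of x p] assms by simp
  then have "(1 + x * p) / (1 + x * q) < 1"
    using assms by (auto simp: divide_less_eq_1 intro!: add_pos_nonneg)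
  then have "(1 + x * p) / (1 + x * q) * marginal_rate x p < 1 * marginal_rate x p"
    using assms by (intro mult_strict_right_mono) auto
  with marginal_rate_upper_scaling[of x p q] assms show ?thesis by simp
qed

text \<open>The lower scaling gives an explicit Lipschitz constant: with \<open>r\<close> the ratio
  of the factors, the loss is at most \<open>1 - r\<^sup>2 \<le> 2 * (1 - r)\<close> times a rate
  that is itself at most \<open>x\<close>, and \<open>1 - r \<le> x * (q - p)\<close>.\<close>

lemma marginal_rate_continuous:
  assumes "0 \<le> x"
  shows "continuous_on {0..} (marginal_rate x)"
proof -
  have ord: "dist (marginal_rate x p) (marginal_rate x q) \<le> (2 * x\<^sup>2) * dist p q"
    if pq: "0 \<le> p" "p \<le> q" for p q
  proof -
    have pos: "1 + x * q > 0" "1 + x * p > 0" using assms pq by (auto intro: add_pos_nonneg)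
    define r where "r = (1 + x * p) / (1 + x * q)"
    have r: "1 - r = x * (q - p) / (1 + x * q)" unfolding r_def using pos by (simp add: field_simps)
    have "x * (q - p) / (1 + x * q) \<le> x * (q - p) / 1"
      using assms pq pos by (intro divide_left_mono) auto
    with r have r1: "1 - r \<le> x * (q - p)" by simp
    have "r \<le> 1"
      unfolding r_def using pos assms pq by (auto simp: divide_le_eq_1 intro!: mult_left_mono)
    have "marginal_rate x p - marginal_rate x q \<le> (1 - r\<^sup>2) * marginal_rate x p"
      using marginal_rate_lower_scaling[OF assms pq] unfolding r_def by (simp add: algebra_simps)
    also have "\<dots> \<le> (2 * (1 - r)) * marginal_rate x p"
      using marginal_rate_nonneg pq zero_le_power2[of "1 - r"]
      by (intro mult_right_mono) (auto simp: power2_eq_square algebra_simps)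
    also have "\<dots> \<le> (2 * (x * (q - p))) * x"
      using r1 \<open>r \<le> 1\<close> marginal_rate_nonneg marginal_rate_le_gain assms pq by (intro mult_mono) auto
    finally show ?thesis
      using marginal_rate_antimono[OF assms pq] pq by (simp add: dist_real_def power2_eq_square algebra_simps)
  qed
  have "(2 * x\<^sup>2)-lipschitz_on {0..} (marginal_rate x)"
  proof (rule lipschitz_onI)
    fix p q :: real assume "p \<in> {0..}" "q \<in> {0..}"
    then show "dist (marginal_rate x p) (marginal_rate x q) \<le> 2 * x\<^sup>2 * dist p q"
      using ord[of p q] ord[of q p] by (cases "p \<le> q") (auto simp: dist_commute)
  qed simp
  then show ?thesis by (rule lipschitz_on_continuous_on)
qed

text \<open>The integrated tangent inequality makes \<open>marginal_rate x p\<close> a supergradient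
  of \<open>secrecy_rate x\<close> at \<open>p\<close>, so the integral never has to be
  differentiated.\<close>

lemma secrecy_rate_diff_le:
  assumes "0 \<le> p" "0 \<le> q"
  shows "secrecy_rate x q - secrecy_rate x p \<le> marginal_rate x p * (q - p)"
proof -
  have "secrecy_rate x q - secrecy_rate x p
    = (LINT y:{0..x}|M. (ln (1 + x * q) - ln (1 + y * q)) - (ln (1 + x * p) - ln (1 + y * p)))"
    unfolding secrecy_rate_def using set_integrable_rate assms by (intro set_integral_diff(2)[symmetric]) auto
  also have "\<dots> \<le> (LINT y:{0..x}|M. (x / (1 + x * p) - y / (1 + y * p)) * (q - p))"
    by (intro set_integral_mono set_integral_diff(1)[OF set_integrable_rate set_integrable_rate]
          set_integrable_mult_left impI set_integrable_marginal ln_ratio_diff_le) (use assms in auto)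
  also have "\<dots> = marginal_rate x p * (q - p)" by (simp add: marginal_rate_def)
  finally show ?thesis .
qed

lemma marginal_rate_measurable [measurable]:
  "(\<lambda>x. marginal_rate x p) \<in> borel_measurable borel"
proof -
  \<comment> \<open>The endpoint \<open>x\<close> moves into a jointly measurable integrand, so that
    measurability of integrals with a parameter applies.\<close>
  have "marginal_rate = (\<lambda>x p. LINT y|M. (if 0 \<le> y \<and> y \<le> x then x / (1 + x * p) - y / (1 + y * p) else 0))"
    unfolding marginal_rate_def set_lebesgue_integral_def
    by (intro ext Bochner_Integration.integral_cong) (auto simp: indicator_def)
  then show ?thesis by simp
qed

section \<open>Optimal power at a fixed gain\<close>

text \<open>The Karush-Kuhn-Tucker conditions for maximizing \<open>secrecy_rate x p - lam * p\<close> over \<open>p \<ge> 0\<close>.\<close>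

definition kkt :: "real \<Rightarrow> real \<Rightarrow> real \<Rightarrow> bool" where
  "kkt lam x p \<longleftrightarrow> 0 \<le> p \<and> marginal_rate x p \<le> lam \<and> (0 < p \<longrightarrow> marginal_rate x p = lam)"

text \<open>Strict decrease of a positive marginal rate makes this an equivalence. It yields
  uniqueness, monotonicity in \<open>lam\<close>, measurability of the policy in \<open>x\<close>,
  and lower bounds on the power for small \<open>lam\<close>.\<close>

lemma kkt_less_iff:
  assumes "kkt lam x p" "0 < lam" "0 \<le> x" "0 \<le> t"
  shows "t < p \<longleftrightarrow> lam < marginal_rate x t"
proof
  assume "t < p"
  then have "marginal_rate x p = lam" using assms unfolding kkt_def by auto
  moreover have "0 < marginal_rate x t"
    using marginal_rate_antimono[of x t p] assms \<open>t < p\<close> calculation by auto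
  ultimately show "lam < marginal_rate x t"
    using marginal_rate_strict_antimono[of x t p] assms \<open>t < p\<close> by auto
next
  assume "lam < marginal_rate x t"
  then show "t < p" using marginal_rate_antimono[of x p t] assms unfolding kkt_def by force
qed

lemma kkt_unique:
  assumes "kkt lam x p" "kkt lam x q" "0 < lam" "0 \<le> x"
  shows "p = q"
proof (rule linorder_cases[of p q])
  assume "p < q"
  then show ?thesis using kkt_less_iff[OF assms(2-4), of p] assms(1) by (auto simp: kkt_def)
next
  assume "q < p"
  then show ?thesis using kkt_less_iff[OF assms(1,3,4), of q] assms(2) by (auto simp: kkt_def)
qed

text \<open>If \<open>p > 0\<close>, then \<open>lam \<le> x / (1 + x * p)\<close>, which is below
  \<open>1 / p\<close>. The bound is uniform in \<open>x\<close>, so the policy is integrable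
  against every law of the main gain.\<close>

lemma kkt_le:
  assumes "kkt lam x p" "0 < lam" "0 \<le> x"
  shows "p \<le> 1 / lam"
proof (cases "p > 0")
  case True
  then have "lam \<le> x / (1 + x * p)" using marginal_rate_le[of x p] assms by (auto simp: kkt_def)
  moreover have "1 + x * p > 0" using True assms by (auto intro: add_pos_nonneg)
  ultimately have "lam * (1 + x * p) \<le> x" by (simp add: field_simps)
  with assms(2) have "x * (lam * p) < x * 1" by (simp add: algebra_simps)
  then have "lam * p < 1" using assms(3) by (simp only: mult_less_cancel_left)
  with assms show ?thesis by (simp add: field_simps)
qed (use assms in \<open>auto simp: kkt_def\<close>)

text \<open>Either power 0 qualifies, or the marginal rate starts above \<open>lam\<close> and has
  fallen to at most \<open>lam\<close> at power \<open>1 / lam\<close>, so the intermediate value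
  theorem applies.\<close>

lemma kkt_exists:
  assumes "0 < lam" "0 \<le> x"
  shows "\<exists>p. kkt lam x p"
proof (cases "marginal_rate x 0 \<le> lam")
  case True
  then show ?thesis by (intro exI[of _ 0]) (auto simp: kkt_def)
next
  case False
  have "x / (1 + x * (1 / lam)) \<le> lam"
    using assms by (auto simp: divide_simps algebra_simps add_pos_nonneg)
  then have "marginal_rate x (1 / lam) \<le> lam" using marginal_rate_le[of x "1 / lam"] assms by auto
  then have "\<exists>p\<ge>0. p \<le> 1 / lam \<and> marginal_rate x p = lam"
    using False assms
    by (intro IVT2' continuous_on_subset[OF marginal_rate_continuous]) auto
  then show ?thesis by (auto simp: kkt_def)
qed

text \<open>Existence and uniqueness turn the case distinction of the policy (the positive root if
  there is one, else 0) into a single condition.\<close>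

lemma kkt_iff:
  assumes "0 < lam" "0 \<le> x"
  shows "kkt lam x p \<longleftrightarrow>
    (if \<exists>p>0. marginal_rate x p = lam then p > 0 \<and> marginal_rate x p = lam else p = 0)"
proof -
  obtain r where r: "kkt lam x r" using kkt_exists[OF assms] ..
  have sol: "kkt lam x t" if "0 < t" "marginal_rate x t = lam" for t
    using that by (simp add: kkt_def)
  show ?thesis
  proof (cases "\<exists>p>0. marginal_rate x p = lam")
    case True
    then have "0 < r" using sol kkt_unique[OF r _ assms] by blast
    have "kkt lam x p \<longleftrightarrow> 0 < p \<and> marginal_rate x p = lam"
      using sol[of p] kkt_unique[OF r _ assms, of p] \<open>0 < r\<close> by (auto simp: kkt_def)
    with True show ?thesis by simp
  next
    case False
    then have "r = 0" using r by (auto simp: kkt_def)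
    then have "kkt lam x p \<longleftrightarrow> p = 0" using r kkt_unique[OF r _ assms, of p] by auto
    then show ?thesis unfolding if_not_P[OF False] .
  qed
qed

text \<open>The upper scaling gives \<open>lam * (1 + x * p) \<le> mu * (1 + x * q)\<close>. A
  positive power at \<open>lam\<close> forces \<open>lam < x\<close>, and together with
  \<open>q \<le> 1 / lam\<close> this makes the constant independent of \<open>x\<close>.\<close>

lemma kkt_lipschitz:
  assumes "kkt lam x p" "kkt mu x q" "0 < lam" "lam \<le> mu" "0 \<le> x"
  shows "q \<le> p" "p - q \<le> 2 / lam\<^sup>2 * (mu - lam)"
proof -
  show "q \<le> p"
    using kkt_less_iff[OF assms(1,3,5), of p] kkt_less_iff[OF assms(2) _ assms(5), of p] assms
    by (auto simp: kkt_def not_le)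
  show "p - q \<le> 2 / lam\<^sup>2 * (mu - lam)"
  proof (cases "q < p")
    case True
    have q0: "0 \<le> q" and p0: "0 < p" using assms True by (auto simp: kkt_def)
    have "lam < x"
      using kkt_less_iff[OF assms(1,3,5), of 0] marginal_rate_le_gain[of x 0] assms p0 by auto
    have pos: "1 + x * p > 0" using p0 assms by (auto intro: add_pos_nonneg)
    have "lam = marginal_rate x p" using assms p0 by (auto simp: kkt_def)
    also have "\<dots> \<le> (1 + x * q) / (1 + x * p) * marginal_rate x q"
      using marginal_rate_upper_scaling[of x q p] assms q0 True by auto
    also have "\<dots> \<le> (1 + x * q) / (1 + x * p) * mu"
      using assms(2,5) q0 pos by (intro mult_left_mono) (auto simp: kkt_def)
    finally have "lam * (1 + x * p) \<le> mu * (1 + x * q)" using pos by (simp add: field_simps)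
    then have "lam * x * (p - q) \<le> (mu - lam) * (1 + x * q)" by (simp add: algebra_simps)
    then have "p - q \<le> (mu - lam) * (1 + x * q) / (lam * x)"
      using assms \<open>lam < x\<close> by (simp add: pos_le_divide_eq mult.commute)
    also have "\<dots> = (mu - lam) * ((1 / x + q) / lam)" using assms \<open>lam < x\<close> by (simp add: field_simps)
    also have "\<dots> \<le> (mu - lam) * ((1 / lam + 1 / lam) / lam)"
    proof -
      have "q \<le> 1 / lam" using kkt_le[OF assms(1,3,5)] True by auto
      moreover have "1 / x \<le> 1 / lam" using assms \<open>lam < x\<close> by (intro divide_left_mono) auto
      ultimately show ?thesis using assms by (intro mult_left_mono divide_right_mono) auto
    qed
    also have "\<dots> = 2 / lam\<^sup>2 * (mu - lam)" by (simp add: power2_eq_square)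
    finally show ?thesis .
  next
    case False
    then show ?thesis using assms by (smt (verit) divide_nonneg_nonneg mult_nonneg_nonneg zero_le_power2)
  qed
qed

text \<open>The Lagrangian inequality is stated with sums on both sides, so that it can be
  integrated in \<open>[0, \<infinity>]\<close> without subtraction.\<close>

lemma kkt_optimal:
  assumes "kkt lam x p" "0 \<le> q"
  shows "secrecy_rate x q + lam * p \<le> secrecy_rate x p + lam * q"
proof -
  have "marginal_rate x p * (q - p) \<le> lam * (q - p)"
    using assms by (cases "p > 0") (auto simp: kkt_def intro: mult_right_mono)
  with secrecy_rate_diff_le[of p q x] assms show ?thesis by (auto simp: kkt_def algebra_simps)
qed

lemma kkt_optimal_strict:
  assumes "kkt lam x p" "0 < lam" "0 \<le> x" "0 \<le> q" "q \<noteq> p"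
  shows "secrecy_rate x q + lam * p < secrecy_rate x p + lam * q"
proof -
  \<comment> \<open>Passing through the midpoint turns strict monotonicity of \<open>marginal_rate\<close> into strict concavity.\<close>
  define m where "m = (p + q) / 2"
  have p: "0 \<le> p" and m: "0 \<le> m" using assms by (auto simp: kkt_def m_def)
  have "secrecy_rate x q - secrecy_rate x p
    \<le> marginal_rate x m * (q - m) + marginal_rate x p * (m - p)"
    using secrecy_rate_diff_le[OF m assms(4), of x] secrecy_rate_diff_le[OF p m, of x] by simp
  also have "\<dots> = (marginal_rate x m + marginal_rate x p) / 2 * (q - p)"
    by (simp add: m_def field_simps)
  also have "\<dots> < lam * (q - p)"
  proof (cases "p < q")
    case True
    then have "p < m" by (simp add: m_def)
    have "marginal_rate x p \<le> lam" using assms by (simp add: kkt_def)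
    moreover have "marginal_rate x m < lam"
      using kkt_less_iff[OF assms(1-3) m] \<open>p < m\<close> marginal_rate_strict_antimono[OF assms(3) p \<open>p < m\<close>]
        marginal_rate_antimono[OF assms(3) p, of m] calculation assms(2)
      by linarith
    ultimately show ?thesis using True by (intro mult_strict_right_mono) auto
  next
    case False
    then have "m < p" "0 < p" using assms by (auto simp: m_def)
    then have "lam < marginal_rate x m" "marginal_rate x p = lam"
      using kkt_less_iff[OF assms(1-3) m] assms by (auto simp: kkt_def)
    then show ?thesis using False assms by (intro mult_strict_right_mono_neg) auto
  qed
  finally show ?thesis by (simp add: algebra_simps)
qed

section \<open>Optimality of the policy under the average power constraint\<close>

lemma secrecy_rate_measurable [measurable (raw)]:
  assumes [measurable]: "P \<in> borel_measurable borel"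
  shows "(\<lambda>x. secrecy_rate x (P x)) \<in> borel_measurable borel"
proof -
  have "(\<lambda>x. secrecy_rate x (P x))
      = (\<lambda>x. LINT y|M. (if 0 \<le> y \<and> y \<le> x then ln (1 + x * P x) - ln (1 + y * P x) else 0))"
    unfolding secrecy_rate_def set_lebesgue_integral_def
    by (intro ext Bochner_Integration.integral_cong) (auto simp: indicator_def)
  then show ?thesis by simp
qed

lemma nn_integral_rate_eq:
  assumes nonneg: "AE y in M. 0 \<le> y" and "0 \<le> x" "0 \<le> p"
  shows "(\<integral>\<^sup>+y. ennreal (max 0 (ln (1 + x * p) - ln (1 + y * p))) \<partial>M) = ennreal (secrecy_rate x p)"
proof -
  have "(\<integral>\<^sup>+y. ennreal (max 0 (ln (1 + x * p) - ln (1 + y * p))) \<partial>M)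
      = (\<integral>\<^sup>+y. ennreal (indicator {0..x} y *\<^sub>R (ln (1 + x * p) - ln (1 + y * p))) \<partial>M)"
  proof (rule nn_integral_cong_AE, use nonneg in eventually_elim)
    fix y :: real assume y: "0 \<le> y"
    show "ennreal (max 0 (ln (1 + x * p) - ln (1 + y * p)))
      = ennreal (indicator {0..x} y *\<^sub>R (ln (1 + x * p) - ln (1 + y * p)))"
    proof (cases "y \<le> x")
      case True
      then show ?thesis using rate_kernel_bounds[of y x p] assms y by (simp add: max_def)
    next
      case False
      then have "x * p \<le> y * p" "0 \<le> x * p" using assms by (auto intro: mult_right_mono)
      then have "ln (1 + x * p) \<le> ln (1 + y * p)" by simp
      with False show ?thesis by simp
    qed
  qed
  also have "\<dots> = ennreal (secrecy_rate x p)"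
    unfolding secrecy_rate_def set_lebesgue_integral_def
    using set_integrable_rate[OF assms(3), of x] rate_kernel_bounds[of _ x p] assms(3)
    by (intro nn_integral_eq_integral) (auto simp: set_integrable_def indicator_def)
  finally show ?thesis .
qed

text \<open>Here \<open>N\<close> is the law of the main gain. Integrating the pointwise Lagrangian
  inequality gives optimality. If the objectives agree and are finite, the integrands agree almost
  everywhere, and the strict inequality then identifies the policies.\<close>

lemma kkt_policy_optimal:
  fixes P Q :: "real \<Rightarrow> real"
  assumes N: "real_distribution N"
    and meas: "P \<in> borel_measurable borel" "Q \<in> borel_measurable borel"
    and kkt: "AE x in N. 0 \<le> x \<and> kkt lam x (P x)" "0 < lam"
    and Q: "AE x in N. 0 \<le> Q x"
    and power: "(\<integral>\<^sup>+x. ennreal (P x) \<partial>N) = ennreal b" "(\<integral>\<^sup>+x. ennreal (Q x) \<partial>N) \<le> ennreal b"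
  shows "(\<integral>\<^sup>+x. ennreal (secrecy_rate x (Q x)) \<partial>N) \<le> (\<integral>\<^sup>+x. ennreal (secrecy_rate x (P x)) \<partial>N)"
    and "(\<integral>\<^sup>+x. ennreal (secrecy_rate x (Q x)) \<partial>N) = (\<integral>\<^sup>+x. ennreal (secrecy_rate x (P x)) \<partial>N)
      \<Longrightarrow> (\<integral>\<^sup>+x. ennreal (secrecy_rate x (P x)) \<partial>N) < \<infinity> \<Longrightarrow> AE x in N. Q x = P x"
proof -
  interpret N: real_distribution N by (rule N)
  note [measurable] = meas
  let ?J = "\<lambda>P. \<integral>\<^sup>+x. ennreal (secrecy_rate x (P x)) \<partial>N"
  let ?f = "\<lambda>x. ennreal (secrecy_rate x (Q x)) + ennreal lam * ennreal (P x)"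
  let ?g = "\<lambda>x. ennreal (secrecy_rate x (P x)) + ennreal lam * ennreal (Q x)"
  \<comment> \<open>Equality holds here because \<open>P\<close> spends the whole budget; for
    \<open>?g\<close> there is only an upper bound, since \<open>Q\<close> may spend less.\<close>
  have f: "(\<integral>\<^sup>+x. ?f x \<partial>N) = ?J Q + ennreal lam * ennreal b"
    using power(1) by (simp add: nn_integral_add nn_integral_cmult)
  have "(\<integral>\<^sup>+x. ?g x \<partial>N) = ?J P + ennreal lam * (\<integral>\<^sup>+x. ennreal (Q x) \<partial>N)"
    by (simp add: nn_integral_add nn_integral_cmult)
  then have g: "(\<integral>\<^sup>+x. ?g x \<partial>N) \<le> ?J P + ennreal lam * ennreal b"
    using power(2) by (simp add: add_left_mono mult_left_mono)
  have real_form: "?f x = ennreal (secrecy_rate x (Q x) + lam * P x)"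
    "?g x = ennreal (secrecy_rate x (P x) + lam * Q x)" if "kkt lam x (P x)" "0 \<le> Q x" for x
    using that kkt(2) secrecy_rate_nonneg by (auto simp: kkt_def ennreal_mult ennreal_plus)
  have le: "AE x in N. ?f x \<le> ?g x"
    using kkt(1) Q
  proof eventually_elim
    fix x assume "0 \<le> x \<and> kkt lam x (P x)" "0 \<le> Q x"
    then show "?f x \<le> ?g x"
      using kkt_optimal[of lam x "P x" "Q x"] by (simp add: real_form ennreal_leI del: ennreal_plus)
  qed
  have "?J Q + ennreal lam * ennreal b \<le> ?J P + ennreal lam * ennreal b"
    using order_trans[OF nn_integral_mono_AE[OF le] g] unfolding f .
  \<comment> \<open>Only the power term is cancelled, and it is finite even when the objectives are
    infinite.\<close>
  moreover have "ennreal lam * ennreal b \<noteq> \<top>" by (simp add: ennreal_mult_eq_top_iff)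
  ultimately show "?J Q \<le> ?J P"
    by (simp add: ennreal_add_left_cancel_le add.commute)
  assume eq: "?J Q = ?J P" and fin: "?J P < \<infinity>"
  \<comment> \<open>Otherwise the integral of \<open>?g\<close> would strictly exceed that of
    \<open>?f\<close>; this inference needs the latter to be finite, which is the purpose of
    \<open>fin\<close>.\<close>
  have ge: "AE x in N. ?g x \<le> ?f x"
  proof (rule ccontr)
    assume "\<not> ?thesis"
    moreover have "(\<integral>\<^sup>+x. ?f x \<partial>N) \<noteq> \<infinity>"
      unfolding f eq using fin by (simp add: ennreal_mult_eq_top_iff)
    ultimately have "(\<integral>\<^sup>+x. ?f x \<partial>N) < (\<integral>\<^sup>+x. ?g x \<partial>N)"
      using le by (intro nn_integral_less) auto
    with f g eq show False by simp
  qed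
  show "AE x in N. Q x = P x"
    using kkt(1) Q ge
  proof eventually_elim
    fix x assume x: "0 \<le> x \<and> kkt lam x (P x)" "0 \<le> Q x" "?g x \<le> ?f x"
    then have "secrecy_rate x (P x) + lam * Q x \<le> secrecy_rate x (Q x) + lam * P x"
      using kkt(2) secrecy_rate_nonneg[of "Q x" x]
      by (simp add: real_form ennreal_le_iff kkt_def del: ennreal_plus)
    then show "Q x = P x"
      using kkt_optimal_strict[of lam x "P x" "Q x"] x kkt(2) by force
  qed
qed

section \<open>Choice of the multiplier that exhausts the power budget\<close>

text \<open>The value 0 at negative gains makes the policy equal to its own restriction to the half
  line.\<close>

definition kkt_power :: "real \<Rightarrow> real \<Rightarrow> real" where
  "kkt_power lam x = (if 0 \<le> x then THE p. kkt lam x p else 0)"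

lemma kkt_kkt_power:
  assumes "0 < lam" "0 \<le> x"
  shows "kkt lam x (kkt_power lam x)"
proof -
  have "\<exists>!p. kkt lam x p" using kkt_exists[OF assms] kkt_unique[OF _ _ assms] by blast
  then show ?thesis using assms theI'[of "kkt lam x"] by (simp add: kkt_power_def)
qed

lemma kkt_power_bounds:
  assumes "0 < lam"
  shows "0 \<le> kkt_power lam x" "kkt_power lam x \<le> 1 / lam"
  using kkt_kkt_power[of lam x] kkt_le[of lam x] assms
  by (cases "0 \<le> x"; auto simp: kkt_def kkt_power_def)+

text \<open>For \<open>t \<ge> 0\<close> the superlevel set at \<open>t\<close> is described by
  \<open>lam < marginal_rate x t\<close>, a measurable condition on \<open>x\<close>.\<close>

lemma kkt_power_measurable:
  assumes "0 < lam"
  shows "kkt_power lam \<in> borel_measurable borel"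
  unfolding borel_measurable_iff_greater
proof
  fix t
  show "{x \<in> space borel. t < kkt_power lam x} \<in> sets borel"
  proof (cases "0 \<le> t")
    case True
    then have "t < kkt_power lam x \<longleftrightarrow> 0 \<le> x \<and> lam < marginal_rate x t" for x
      using kkt_less_iff[OF kkt_kkt_power, of lam x t] assms
      by (cases "0 \<le> x") (auto simp: kkt_power_def)
    then show ?thesis by simp
  next
    case False
    then have "t < kkt_power lam x" for x using kkt_power_bounds(1)[OF assms, of x] by linarith
    then show ?thesis by simp
  qed
qed

text \<open>The mean power \<open>A\<close> is continuous in the multiplier, at most
  \<open>b\<close> at \<open>1 / b\<close>, and at least \<open>b\<close> at a small
  \<open>a\<close>. The last bound comes from a set \<open>S\<close> of positive probability on
  which the gain is bounded and the marginal rate at 0 is bounded away from 0.\<close>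

lemma exists_multiplier:
  assumes N: "real_distribution N"
    and nontriv: "\<not> (AE x in N. 0 \<le> x \<longrightarrow> marginal_rate x 0 \<le> 0)"
    and "0 < b"
  shows "\<exists>lam>0. (\<integral>\<^sup>+x. ennreal (kkt_power lam x) \<partial>N) = ennreal b"
proof -
  interpret N: real_distribution N by (rule N)
  define A where "A lam = (LINT x|N. kkt_power lam x)" for lam
  have meas[measurable]: "kkt_power lam \<in> borel_measurable N" if "0 < lam" for lam
    using kkt_power_measurable[OF that] by simp
  have int: "integrable N (kkt_power lam)" if "0 < lam" for lam
    using kkt_power_bounds[OF that] meas[OF that] by (intro N.integrable_const_bound[of _ "1 / lam"]) auto

  \<comment> \<open>The gains with positive marginal rate at 0 are a countable union of sets with
    \<open>x \<le> n + 1\<close> and rate above \<open>1 / (n + 1)\<close>, so one of these sets is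
    not null.\<close>
  have "\<exists>n. \<not> (AE x in N. 0 \<le> x \<longrightarrow> x \<le> real (Suc n) \<longrightarrow> marginal_rate x 0 \<le> 1 / real (Suc n))"
  proof (rule ccontr)
    assume "\<not> ?thesis"
    then have "AE x in N. \<forall>n. 0 \<le> x \<longrightarrow> x \<le> real (Suc n) \<longrightarrow> marginal_rate x 0 \<le> 1 / real (Suc n)"
      unfolding AE_all_countable by blast
    then have "AE x in N. 0 \<le> x \<longrightarrow> marginal_rate x 0 \<le> 0"
    proof eventually_elim
      fix x assume *: "\<forall>n. 0 \<le> x \<longrightarrow> x \<le> real (Suc n) \<longrightarrow> marginal_rate x 0 \<le> 1 / real (Suc n)"
      show "0 \<le> x \<longrightarrow> marginal_rate x 0 \<le> 0"
      proof (rule ccontr)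
        assume "\<not> (0 \<le> x \<longrightarrow> marginal_rate x 0 \<le> 0)"
        then have x: "0 \<le> x" "0 < marginal_rate x 0" by auto
        obtain n where n: "max x (1 / marginal_rate x 0) < real n" using reals_Archimedean2 by blast
        with x have "1 / real (Suc n) < marginal_rate x 0" by (auto simp: field_simps)
        moreover have "marginal_rate x 0 \<le> 1 / real (Suc n)" using * x n by simp
        ultimately show False by simp
      qed
    qed
    with nontriv show False by contradiction
  qed
  then obtain n where n: "\<not> (AE x in N. 0 \<le> x \<longrightarrow> x \<le> real (Suc n) \<longrightarrow> marginal_rate x 0 \<le> 1 / real (Suc n))" ..
  define c where "c = real (Suc n)"
  have "c > 0" by (simp add: c_def)
  define S where "S = {x. 0 \<le> x \<and> x \<le> c \<and> 1 / c < marginal_rate x 0}"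
  have S[measurable]: "S \<in> sets borel" unfolding S_def by measurable
  have "N.prob S > 0"
  proof -
    have "N.prob S \<noteq> 0"
    proof
      assume "N.prob S = 0"
      then have "AE x in N. x \<notin> S" using S by (intro AE_not_in) (auto simp: N.emeasure_eq_measure null_sets_def)
      then have "AE x in N. 0 \<le> x \<longrightarrow> x \<le> c \<longrightarrow> marginal_rate x 0 \<le> 1 / c"
        by eventually_elim (auto simp: S_def)
      with n show False by (simp add: c_def)
    qed
    then show ?thesis by (simp add: zero_less_measure_iff)
  qed
  \<comment> \<open>Power \<open>t\<close> on \<open>S\<close> and 0 elsewhere has mean exactly
    \<open>b\<close>.\<close>
  define t where "t = b / N.prob S"
  have "t > 0" using \<open>0 < b\<close> \<open>N.prob S > 0\<close> by (simp add: t_def)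
  \<comment> \<open>The second entry is a lower bound for the marginal rate at power
    \<open>t\<close> on \<open>S\<close>, from the lower scaling; the first keeps
    \<open>{a..1 / b}\<close> nonempty.\<close>
  define a where "a = min (1 / b) ((1 / (1 + c * t))\<^sup>2 * (1 / c))"
  have ct: "1 + c * t > 0" using \<open>c > 0\<close> \<open>t > 0\<close> by (auto intro: add_pos_pos)
  have "a > 0" using \<open>0 < b\<close> \<open>c > 0\<close> ct by (auto simp: a_def)
  have large: "t < kkt_power a x" if "x \<in> S" for x
  proof -
    have x: "0 \<le> x" "x \<le> c" "1 / c < marginal_rate x 0" using that by (auto simp: S_def)
    have "1 + x * t > 0" "1 + x * t \<le> 1 + c * t"
      using x \<open>t > 0\<close> by (auto intro: add_pos_nonneg mult_right_mono)
    then have "(1 / (1 + c * t))\<^sup>2 \<le> (1 / (1 + x * t))\<^sup>2"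
      using ct by (intro power_mono divide_left_mono) auto
    have "a \<le> (1 / (1 + c * t))\<^sup>2 * (1 / c)" by (simp add: a_def)
    also have "\<dots> < (1 / (1 + c * t))\<^sup>2 * marginal_rate x 0"
      using x ct by (intro mult_strict_left_mono) auto
    also have "\<dots> \<le> (1 / (1 + x * t))\<^sup>2 * marginal_rate x 0"
      by (intro mult_right_mono marginal_rate_nonneg) (fact | simp)+
    also have "\<dots> \<le> marginal_rate x t"
      using marginal_rate_lower_scaling[of x 0 t] x \<open>t > 0\<close> by simp
    finally show ?thesis using kkt_less_iff[OF kkt_kkt_power, of a x t] x \<open>a > 0\<close> \<open>t > 0\<close> by simp
  qed
  have "b = (LINT x|N. t * indicator S x)"
    using \<open>N.prob S > 0\<close> by (simp add: t_def)
  also have "\<dots> \<le> A a"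
    unfolding A_def
  proof (rule integral_mono)
    show "integrable N (\<lambda>x. t * indicator S x)"
      using \<open>t > 0\<close> by (intro N.integrable_const_bound[of _ t]) (auto simp: indicator_def)
    show "t * indicator S x \<le> kkt_power a x" for x
      using large[of x] kkt_power_bounds(1)[OF \<open>a > 0\<close>, of x] by (auto simp: indicator_def)
  qed (rule int[OF \<open>a > 0\<close>])
  finally have lower: "b \<le> A a" .

  \<comment> \<open>With multiplier \<open>1 / b\<close> no gain receives more power than
    \<open>b\<close>.\<close>
  have "A (1 / b) \<le> (LINT x|N. b)"
    unfolding A_def using int[of "1 / b"] kkt_power_bounds(2)[of "1 / b"] \<open>0 < b\<close>
    by (intro integral_mono) auto
  then have upper: "A (1 / b) \<le> b" using N.prob_space by simp

  have lip: "dist (A l) (A m) \<le> 2 / a\<^sup>2 * dist l m" if "a \<le> l" "l \<le> m" for l m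
  proof -
    have pos: "0 < l" "0 < m" using that \<open>a > 0\<close> by auto
    have bounds: "kkt_power m x \<le> kkt_power l x" "kkt_power l x - kkt_power m x \<le> 2 / a\<^sup>2 * (m - l)" for x
    proof -
      have "2 / l\<^sup>2 * (m - l) \<le> 2 / a\<^sup>2 * (m - l)"
        using that \<open>a > 0\<close> by (intro mult_right_mono divide_left_mono power_mono) auto
      then show "kkt_power m x \<le> kkt_power l x" "kkt_power l x - kkt_power m x \<le> 2 / a\<^sup>2 * (m - l)"
        using kkt_lipschitz[OF kkt_kkt_power kkt_kkt_power, of l x m] that pos
        by (cases "0 \<le> x"; auto simp: kkt_power_def)+
    qed
    have "A m \<le> A l" unfolding A_def using int pos bounds(1) by (intro integral_mono) auto
    moreover have "A l - A m = (LINT x|N. kkt_power l x - kkt_power m x)"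
      unfolding A_def using int pos by simp
    moreover have "\<dots> \<le> (LINT x|N. 2 / a\<^sup>2 * (m - l))"
      using int pos bounds(2) by (intro integral_mono) auto
    ultimately show ?thesis using that N.prob_space by (simp add: dist_real_def)
  qed
  have "(2 / a\<^sup>2)-lipschitz_on {a..1 / b} A"
  proof (rule lipschitz_onI)
    fix l m assume "l \<in> {a..1 / b}" "m \<in> {a..1 / b}"
    then show "dist (A l) (A m) \<le> 2 / a\<^sup>2 * dist l m"
      using lip[of l m] lip[of m l] by (cases "l \<le> m") (auto simp: dist_commute)
  qed simp
  then have "continuous_on {a..1 / b} A" by (rule lipschitz_on_continuous_on)
  moreover have "a \<le> 1 / b" by (simp add: a_def)
  ultimately obtain lam where lam: "a \<le> lam" "A lam = b"
    using IVT2'[of A "1 / b" b a] lower upper by auto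
  then have "0 < lam" using \<open>a > 0\<close> by simp
  have "(\<integral>\<^sup>+x. ennreal (kkt_power lam x) \<partial>N) = ennreal (A lam)"
    unfolding A_def using int[OF \<open>0 < lam\<close>] kkt_power_bounds(1)[OF \<open>0 < lam\<close>]
    by (intro nn_integral_eq_integral) auto
  with \<open>0 < lam\<close> lam show ?thesis by auto
qed

text \<open>At power 0 the kernel is \<open>x - y\<close>, and a nonnegative function with vanishing
  integral vanishes almost everywhere. This links a zero marginal rate to the event that the
  eavesdropper gain is not below \<open>x\<close>.\<close>

lemma AE_ge_of_marginal_rate_0:
  assumes "AE y in M. 0 \<le> y" "marginal_rate x 0 \<le> 0"
  shows "AE y in M. x \<le> y"
proof -
  have "(LINT y|M. indicator {0..x} y *\<^sub>R (x - y)) = 0"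
    using assms(2) marginal_rate_nonneg[of 0 x]
    by (simp add: marginal_rate_def set_lebesgue_integral_def)
  moreover have "integrable M (\<lambda>y. indicator {0..x} y *\<^sub>R (x - y))"
    using set_integrable_marginal[of 0 x] by (simp add: set_integrable_def)
  ultimately have "AE y in M. indicator {0..x} y *\<^sub>R (x - y) = 0"
    by (subst (asm) integral_nonneg_eq_0_iff_AE) (auto simp: indicator_def)
  with assms(1) show ?thesis
    by eventually_elim (auto simp: indicator_def split: if_splits)
qed

end

section \<open>Transfer between the gains, their densities and their laws\<close>

lemma gain_density_measurable:
  assumes "has_gain_density \<Omega> h f"
  shows "h \<in> borel_measurable \<Omega>" "(\<lambda>x. indicator {0..} x * f x) \<in> borel_measurable borel"
proof -
  show "h \<in> borel_measurable \<Omega>"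
    using assms by (simp add: has_gain_density_def distributed_def)
  have "(\<lambda>x. indicator {0..} x *\<^sub>R f x) \<in> borel_measurable borel"
    using assms by (intro borel_measurable_continuous_on_indicator) (auto simp: has_gain_density_def)
  then show "(\<lambda>x. indicator {0..} x * f x) \<in> borel_measurable borel" by simp
qed

lemma gain_law_eq_density:
  assumes "has_gain_density \<Omega> h f"
  shows "distr \<Omega> borel h = density lborel (\<lambda>x. ennreal (indicator {0..} x * f x))"
proof -
  have "distr \<Omega> borel h = distr \<Omega> lborel h" by (rule distr_cong) auto
  then show ?thesis using assms by (simp add: has_gain_density_def distributed_def)
qed

lemma real_distribution_gain_law:
  assumes "prob_space \<Omega>" "has_gain_density \<Omega> h f"
  shows "real_distribution (distr \<Omega> borel h)"
proof -
  interpret prob_space \<Omega> by fact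
  show ?thesis using gain_density_measurable(1)[OF assms(2)] by (rule real_distribution_distr)
qed

lemma AE_gain_law_nonneg:
  assumes "has_gain_density \<Omega> h f" "\<forall>\<omega>\<in>space \<Omega>. 0 \<le> h \<omega>"
  shows "AE x in distr \<Omega> borel h. 0 \<le> x"
  using gain_density_measurable[OF assms(1)] assms(2) by (subst AE_distr_iff) auto

lemma nn_integral_gain_law:
  assumes "has_gain_density \<Omega> h f" and [measurable]: "g \<in> borel_measurable borel"
  shows "(\<integral>\<^sup>+x. g x \<partial>distr \<Omega> borel h) = (\<integral>\<^sup>+x\<in>{0..}. ennreal (f x) * g x \<partial>lborel)"
proof -
  have [measurable]: "(\<lambda>x. ennreal (indicator {0..} x * f x)) \<in> borel_measurable borel"
    using gain_density_measurable(2)[OF assms(1)] by (rule measurable_compose) simp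
  have "(\<integral>\<^sup>+x. g x \<partial>distr \<Omega> borel h) = (\<integral>\<^sup>+x. ennreal (indicator {0..} x * f x) * g x \<partial>lborel)"
    unfolding gain_law_eq_density[OF assms(1)] by (rule nn_integral_density) measurable
  also have "\<dots> = (\<integral>\<^sup>+x\<in>{0..}. ennreal (f x) * g x \<partial>lborel)"
    by (intro nn_integral_cong) (auto simp: indicator_def)
  finally show ?thesis .
qed

text \<open>Both terms of the kernel are bounded on \<open>{0..x}\<close>, so the integral splits:
  the constant term gives the probability, the other becomes a Lebesgue integral through the
  density.\<close>

lemma power_equation_iff_marginal_rate:
  assumes "prob_space \<Omega>" "has_gain_density \<Omega> hE fE" "\<forall>\<omega>\<in>space \<Omega>. 0 \<le> hE \<omega>" "0 \<le> p"
  shows "power_equation \<Omega> hE fE lam x p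
    \<longleftrightarrow> real_distribution.marginal_rate (distr \<Omega> borel hE) x p = lam"
proof -
  define \<nu> where "\<nu> = distr \<Omega> borel hE"
  interpret \<nu>: real_distribution \<nu> unfolding \<nu>_def using assms by (intro real_distribution_gain_law)
  note [measurable] = gain_density_measurable[OF assms(2)]
  have const: "set_integrable \<nu> {0..x} (\<lambda>y. c)" for c :: real
    unfolding set_integrable_def by (intro integrable_scaleR_left \<nu>.integrable_const_bound[of _ 1]) auto
  have frac: "set_integrable \<nu> {0..x} (\<lambda>y. y / (1 + y * p))"
  proof (rule \<nu>.set_integrable_of_bounds)
    fix y assume y: "y \<in> {0..x}"
    then have "y / (1 + y * p) \<le> y / 1" using assms(4) by (intro divide_left_mono) (auto intro: add_pos_nonneg)
    then show "0 \<le> y / (1 + y * p) \<and> y / (1 + y * p) \<le> x" using y assms(4) by auto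
  qed measurable
  have "hE -` {0..x} \<inter> space \<Omega> = {\<omega> \<in> space \<Omega>. hE \<omega> \<le> x}" using assms(3) by auto
  then have "\<nu>.prob {0..x} = \<P>(\<omega> in \<Omega>. hE \<omega> \<le> x)" unfolding \<nu>_def by (subst measure_distr) auto
  then have 1: "(LINT y:{0..x}|\<nu>. x / (1 + x * p)) = x * \<P>(\<omega> in \<Omega>. hE \<omega> \<le> x) / (1 + x * p)"
    by (simp add: set_lebesgue_integral_def)
  have "(LINT y:{0..x}|\<nu>. y / (1 + y * p))
      = (LINT y|lborel. (indicator {0..} y * fE y) *\<^sub>R (indicator {0..x} y *\<^sub>R (y / (1 + y * p))))"
    unfolding \<nu>_def gain_law_eq_density[OF assms(2)] set_lebesgue_integral_def
  proof (rule integral_density)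
    show "AE y in lborel. 0 \<le> indicator {0..} y * fE y"
      using assms(2) by (intro AE_I2) (simp add: has_gain_density_def indicator_def)
  qed measurable
  also have "\<dots> = (LBINT y:{0..x}. y / (1 + y * p) * fE y)"
    unfolding set_lebesgue_integral_def
    by (intro Bochner_Integration.integral_cong) (auto simp: indicator_def)
  finally have 2: "(LINT y:{0..x}|\<nu>. y / (1 + y * p)) = (LBINT y:{0..x}. y / (1 + y * p) * fE y)" .
  have "\<nu>.marginal_rate x p
      = x * \<P>(\<omega> in \<Omega>. hE \<omega> \<le> x) / (1 + x * p) - (LBINT y:{0..x}. y / (1 + y * p) * fE y)"
    unfolding \<nu>.marginal_rate_def 1[symmetric] 2[symmetric] by (rule set_integral_diff(2)[OF const frac])
  then show ?thesis
    unfolding power_equation_def \<nu>_def by (simp only: eq_iff_diff_eq_0[symmetric])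
qed

lemma solves_power_equation_iff_kkt:
  assumes "prob_space \<Omega>" "has_gain_density \<Omega> hE fE" "\<forall>\<omega>\<in>space \<Omega>. 0 \<le> hE \<omega>" "0 < lam"
  shows "solves_power_equation \<Omega> hE fE lam P
    \<longleftrightarrow> (\<forall>x\<ge>0. real_distribution.kkt (distr \<Omega> borel hE) lam x (P x))"
proof -
  interpret \<nu>: real_distribution "distr \<Omega> borel hE" using assms by (intro real_distribution_gain_law)
  have eq: "0 < p \<and> power_equation \<Omega> hE fE lam x p \<longleftrightarrow> 0 < p \<and> \<nu>.marginal_rate x p = lam" for x p
    using power_equation_iff_marginal_rate[OF assms(1-3)] by (cases "0 < p") auto
  show ?thesis
    unfolding solves_power_equation_def eq using \<nu>.kkt_iff[OF assms(4)] by blast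
qed

text \<open>A policy is constrained only on the half line; multiplying it by the indicator gives a
  function that is Borel measurable and nonnegative on all of the reals.\<close>

lemma secrecy_objective_eq:
  assumes "prob_space \<Omega>" "has_gain_density \<Omega> hM fM" "has_gain_density \<Omega> hE fE"
    and "\<forall>\<omega>\<in>space \<Omega>. 0 \<le> hE \<omega>"
    and P: "set_borel_measurable borel {0..} P" "\<forall>x\<ge>0. 0 \<le> P x"
  shows "secrecy_objective fM fE P
    = (\<integral>\<^sup>+x. ennreal (real_distribution.secrecy_rate (distr \<Omega> borel hE) x (indicator {0..} x * P x))
        \<partial>distr \<Omega> borel hM)"
proof -
  define \<nu> where "\<nu> = distr \<Omega> borel hE"
  interpret \<nu>: real_distribution \<nu> unfolding \<nu>_def using assms by (intro real_distribution_gain_law)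
  have nonneg: "AE y in \<nu>. 0 \<le> y" unfolding \<nu>_def using assms(3,4) by (rule AE_gain_law_nonneg)
  have [measurable]: "(\<lambda>x. indicator {0..} x * P x) \<in> borel_measurable borel"
    using P(1) by (simp add: set_borel_measurable_def)
  have inner: "(\<integral>\<^sup>+y\<in>{0..}. ennreal (max 0 (ln (1 + x * p) - ln (1 + y * p)) * fM x * fE y) \<partial>lborel)
      = ennreal (fM x) * ennreal (\<nu>.secrecy_rate x p)" if "0 \<le> x" "0 \<le> p" for x p
  proof -
    have "(\<integral>\<^sup>+y\<in>{0..}. ennreal (max 0 (ln (1 + x * p) - ln (1 + y * p)) * fM x * fE y) \<partial>lborel)
        = (\<integral>\<^sup>+y\<in>{0..}. ennreal (fE y) * (ennreal (fM x) * ennreal (max 0 (ln (1 + x * p) - ln (1 + y * p)))) \<partial>lborel)"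
    proof (rule nn_integral_cong)
      fix y
      have "0 \<le> fM x" "0 \<le> y \<Longrightarrow> 0 \<le> fE y"
        using assms(2,3) that(1) by (auto simp: has_gain_density_def)
      then show "ennreal (max 0 (ln (1 + x * p) - ln (1 + y * p)) * fM x * fE y) * indicator {0..} y
        = ennreal (fE y) * (ennreal (fM x) * ennreal (max 0 (ln (1 + x * p) - ln (1 + y * p)))) * indicator {0..} y"
        by (cases "0 \<le> y") (simp_all add: ennreal_mult mult_ac)
    qed
    also have "\<dots> = (\<integral>\<^sup>+y. ennreal (fM x) * ennreal (max 0 (ln (1 + x * p) - ln (1 + y * p))) \<partial>\<nu>)"
      unfolding \<nu>_def by (rule nn_integral_gain_law[OF assms(3), symmetric]) measurable
    also have "\<dots> = ennreal (fM x) * (\<integral>\<^sup>+y. ennreal (max 0 (ln (1 + x * p) - ln (1 + y * p))) \<partial>\<nu>)"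
      by (rule nn_integral_cmult) measurable
    finally show ?thesis using \<nu>.nn_integral_rate_eq[OF nonneg that] by simp
  qed
  have "secrecy_objective fM fE P
      = (\<integral>\<^sup>+x\<in>{0..}. ennreal (fM x) * ennreal (\<nu>.secrecy_rate x (indicator {0..} x * P x)) \<partial>lborel)"
    unfolding secrecy_objective_def
  proof (rule nn_integral_cong)
    fix x :: real
    show "(\<integral>\<^sup>+y\<in>{0..}. ennreal (max 0 (ln (1 + x * P x) - ln (1 + y * P x)) * fM x * fE y) \<partial>lborel) * indicator {0..} x
      = ennreal (fM x) * ennreal (\<nu>.secrecy_rate x (indicator {0..} x * P x)) * indicator {0..} x"
    proof (cases "0 \<le> x")
      case True
      then have "indicator {0..} x * P x = P x" "0 \<le> P x" using P(2) by auto
      then show ?thesis using inner[OF True] by (simp only:)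
    next
      case False
      then have "indicator {0..} x = (0 :: ennreal)" by simp
      then show ?thesis by (simp only: mult_zero_right)
    qed
  qed
  also have "\<dots> = (\<integral>\<^sup>+x. ennreal (\<nu>.secrecy_rate x (indicator {0..} x * P x)) \<partial>distr \<Omega> borel hM)"
    by (rule nn_integral_gain_law[OF assms(2), symmetric]) measurable
  finally show ?thesis by (simp add: \<nu>_def)
qed

lemma average_power_eq:
  assumes "h \<in> borel_measurable \<Omega>" "\<forall>\<omega>\<in>space \<Omega>. 0 \<le> h \<omega>"
    and "set_borel_measurable borel {0..} P"
  shows "average_power \<Omega> h P = (\<integral>\<^sup>+x. ennreal (indicator {0..} x * P x) \<partial>distr \<Omega> borel h)"
proof -
  have [measurable]: "(\<lambda>x. indicator {0..} x * P x) \<in> borel_measurable borel" "h \<in> borel_measurable \<Omega>"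
    using assms by (simp_all add: set_borel_measurable_def)
  show ?thesis
    unfolding average_power_def
    by (subst nn_integral_distr) (auto intro!: nn_integral_cong simp: assms(2))
qed

text \<open>If \<open>hE < hM\<close> has probability 0, the marginal rate vanishes for almost every
  main gain, the policy is almost surely 0, and no multiplier can spend the budget; hence the
  premise of the existence part. Uniqueness is claimed for a finite objective, because an infinite
  one is also attained by \<open>P / 2\<close>, by concavity.\<close>

theorem mainTheorem5:
  fixes \<Omega> :: "'a measure"
    and hM hE :: "'a \<Rightarrow> real"
    and fM fE :: "real \<Rightarrow> real"
    and Pbar :: real
  assumes "prob_space \<Omega>"
    and "prob_space.indep_var \<Omega> borel hM borel hE"
    and "\<And>\<omega>. \<omega> \<in> space \<Omega> \<Longrightarrow> 0 \<le> hM \<omega>"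
    and "\<And>\<omega>. \<omega> \<in> space \<Omega> \<Longrightarrow> 0 \<le> hE \<omega>"
    and "has_gain_density \<Omega> hM fM"
    and "has_gain_density \<Omega> hE fE"
    and "Pbar > 0"
  shows
    "(\<forall>lam>0. \<forall>x\<ge>0. (\<exists>p>0. power_equation \<Omega> hE fE lam x p) \<longrightarrow>
        (\<exists>!p. p > 0 \<and> power_equation \<Omega> hE fE lam x p)) \<and>
     (\<P>(\<omega> in \<Omega>. hE \<omega> < hM \<omega>) > 0 \<longrightarrow>
        (\<exists>lam>0. \<exists>P. solves_power_equation \<Omega> hE fE lam P \<and>
           average_power \<Omega> hM P = ennreal Pbar)) \<and>
     (\<forall>lam>0. \<forall>P. solves_power_equation \<Omega> hE fE lam P \<and>
           average_power \<Omega> hM P = ennreal Pbar \<longrightarrow>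
        optimal_policy \<Omega> hM fM fE Pbar P \<and>
        (secrecy_objective fM fE P < \<infinity> \<longrightarrow>
          (\<forall>Q. optimal_policy \<Omega> hM fM fE Pbar Q \<longrightarrow>
             (AE \<omega> in \<Omega>. Q (hM \<omega>) = P (hM \<omega>)))))"
proof -
  interpret \<Omega>: prob_space \<Omega> by fact
  have hM_nonneg: "\<forall>\<omega>\<in>space \<Omega>. 0 \<le> hM \<omega>" and hE_nonneg: "\<forall>\<omega>\<in>space \<Omega>. 0 \<le> hE \<omega>"
    using assms(3,4) by blast+
  define \<mu> where "\<mu> = distr \<Omega> borel hM"
  define \<nu> where "\<nu> = distr \<Omega> borel hE"
  interpret \<mu>: real_distribution \<mu> unfolding \<mu>_def using assms(1,5) by (rule real_distribution_gain_law)
  interpret \<nu>: real_distribution \<nu> unfolding \<nu>_def using assms(1,6) by (rule real_distribution_gain_law)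
  have [measurable]: "hM \<in> borel_measurable \<Omega>" "hE \<in> borel_measurable \<Omega>"
    using gain_density_measurable(1) assms(5,6) by blast+
  have \<mu>_nonneg: "AE x in \<mu>. 0 \<le> x" unfolding \<mu>_def using assms(5) hM_nonneg by (rule AE_gain_law_nonneg)
  have \<nu>_nonneg: "AE y in \<nu>. 0 \<le> y" unfolding \<nu>_def using assms(6) hE_nonneg by (rule AE_gain_law_nonneg)
  note power_eq = power_equation_iff_marginal_rate[OF assms(1,6) hE_nonneg, folded \<nu>_def]
  note solves_iff = solves_power_equation_iff_kkt[OF assms(1,6) hE_nonneg, folded \<nu>_def]
  note objective = secrecy_objective_eq[OF assms(1,5,6) hE_nonneg, folded \<mu>_def \<nu>_def]
  note power = average_power_eq[OF _ hM_nonneg, folded \<mu>_def]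

  have unique: "\<exists>!p. p > 0 \<and> power_equation \<Omega> hE fE lam x p"
    if "0 < lam" "0 \<le> x" "\<exists>p>0. power_equation \<Omega> hE fE lam x p" for lam x
  proof -
    have "\<nu>.kkt lam x p" if "p > 0 \<and> power_equation \<Omega> hE fE lam x p" for p
      using that power_eq[of p lam x] by (simp add: \<nu>.kkt_def)
    then show ?thesis using \<nu>.kkt_unique[OF _ _ that(1,2)] that(3) by blast
  qed

  have existence: "\<exists>lam>0. \<exists>P. solves_power_equation \<Omega> hE fE lam P \<and> average_power \<Omega> hM P = ennreal Pbar"
    if pos: "\<P>(\<omega> in \<Omega>. hE \<omega> < hM \<omega>) > 0"
  proof -
    \<comment> \<open>Otherwise the eavesdropper gain would lie below \<open>x\<close> with
      probability 0 for almost every \<open>x\<close>, and integrating over \<open>x\<close> would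
      contradict \<open>pos\<close>.\<close>
    have "\<not> (AE x in \<mu>. 0 \<le> x \<longrightarrow> \<nu>.marginal_rate x 0 \<le> 0)"
    proof
      assume "AE x in \<mu>. 0 \<le> x \<longrightarrow> \<nu>.marginal_rate x 0 \<le> 0"
      with \<mu>_nonneg have "AE x in \<mu>. emeasure \<nu> {y. y < x} = 0"
      proof eventually_elim
        fix x :: real assume "0 \<le> x" "0 \<le> x \<longrightarrow> \<nu>.marginal_rate x 0 \<le> 0"
        then have "AE y in \<nu>. \<not> y < x"
          using \<nu>.AE_ge_of_marginal_rate_0[OF \<nu>_nonneg, of x] by (simp add: not_less)
        then show "emeasure \<nu> {y. y < x} = 0" by (subst (asm) AE_iff_measurable[of "{y. y < x}"]) auto
      qed
      then have "(\<integral>\<^sup>+x. emeasure \<nu> {y. y < x} \<partial>\<mu>) = (\<integral>\<^sup>+x. 0 \<partial>\<mu>)"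
        by (intro nn_integral_cong_AE) auto
      moreover have "{z \<in> space (borel \<Otimes>\<^sub>M borel). snd z < fst z} \<in> sets (borel \<Otimes>\<^sub>M borel :: (real \<times> real) measure)"
        by measurable
      then have meas: "{z :: real \<times> real. snd z < fst z} \<in> sets (borel \<Otimes>\<^sub>M borel)"
        by (simp add: space_pair_measure)
      ultimately have null: "emeasure (\<mu> \<Otimes>\<^sub>M \<nu>) {z. snd z < fst z} = 0"
        by (subst \<nu>.emeasure_pair_measure_alt) (auto cong: sets_pair_measure_cong)
      \<comment> \<open>Independence identifies the product of the two laws with the joint law of
        the gains.\<close>
      have joint: "\<mu> \<Otimes>\<^sub>M \<nu> = distr \<Omega> (borel \<Otimes>\<^sub>M borel) (\<lambda>\<omega>. (hM \<omega>, hE \<omega>))"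
        using assms(2) unfolding \<Omega>.indep_var_distribution_eq \<mu>_def \<nu>_def by blast
      have "emeasure \<Omega> {\<omega> \<in> space \<Omega>. hE \<omega> < hM \<omega>} = emeasure (\<mu> \<Otimes>\<^sub>M \<nu>) {z. snd z < fst z}"
        unfolding joint by (subst emeasure_distr) (auto simp: meas intro!: arg_cong[where f = "emeasure \<Omega>"])
      with null pos show False by (simp add: measure_def)
    qed
    then obtain lam where lam: "0 < lam" "(\<integral>\<^sup>+x. ennreal (\<nu>.kkt_power lam x) \<partial>\<mu>) = ennreal Pbar"
      using \<nu>.exists_multiplier[OF \<mu>.real_distribution_axioms _ assms(7)] by blast
    have ind: "indicator {0..} x * \<nu>.kkt_power lam x = \<nu>.kkt_power lam x" for x
      by (simp add: \<nu>.kkt_power_def indicator_def)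
    have "average_power \<Omega> hM (\<nu>.kkt_power lam) = ennreal Pbar"
      using power[of "\<nu>.kkt_power lam"] lam \<nu>.kkt_power_measurable[OF lam(1)]
      by (simp add: ind set_borel_measurable_def)
    moreover have "solves_power_equation \<Omega> hE fE lam (\<nu>.kkt_power lam)"
      using solves_iff[OF lam(1)] \<nu>.kkt_kkt_power[OF lam(1)] by blast
    ultimately show ?thesis using lam(1) by blast
  qed

  have optimal: "optimal_policy \<Omega> hM fM fE Pbar P \<and>
      (secrecy_objective fM fE P < \<infinity> \<longrightarrow>
        (\<forall>Q. optimal_policy \<Omega> hM fM fE Pbar Q \<longrightarrow> (AE \<omega> in \<Omega>. Q (hM \<omega>) = P (hM \<omega>))))"
    if "0 < lam" and solves: "solves_power_equation \<Omega> hE fE lam P"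
      and full: "average_power \<Omega> hM P = ennreal Pbar" for lam P
  proof -
    let ?r = "\<lambda>P x. indicator {0..} x * P x :: real"
    have kkt: "\<nu>.kkt lam x (P x)" if "0 \<le> x" for x
      using solves_iff[OF \<open>0 < lam\<close>] solves that by blast
    \<comment> \<open>Measurability of \<open>P\<close> is not assumed; it follows because the power
      equation determines \<open>P\<close> on the half line.\<close>
    have "?r P = \<nu>.kkt_power lam"
    proof
      fix x show "?r P x = \<nu>.kkt_power lam x"
        using \<nu>.kkt_unique[OF kkt \<nu>.kkt_kkt_power, of x] \<open>0 < lam\<close>
        by (cases "0 \<le> x") (auto simp: \<nu>.kkt_power_def)
    qed
    then have meas: "set_borel_measurable borel {0..} P"
      using \<nu>.kkt_power_measurable[OF \<open>0 < lam\<close>] by (simp add: set_borel_measurable_def)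
    have nonneg: "\<forall>x\<ge>0. 0 \<le> P x" using kkt by (simp add: \<nu>.kkt_def)
    have feasible: "feasible_policy \<Omega> hM Pbar P"
      unfolding feasible_policy_def using meas nonneg full by simp
    have best: "secrecy_objective fM fE Q \<le> secrecy_objective fM fE P"
      "secrecy_objective fM fE Q = secrecy_objective fM fE P \<Longrightarrow> secrecy_objective fM fE P < \<infinity>
        \<Longrightarrow> AE \<omega> in \<Omega>. Q (hM \<omega>) = P (hM \<omega>)"
      if "feasible_policy \<Omega> hM Pbar Q" for Q
    proof -
      have Q: "set_borel_measurable borel {0..} Q" "\<forall>x\<ge>0. 0 \<le> Q x"
        "average_power \<Omega> hM Q \<le> ennreal Pbar"
        using that by (auto simp: feasible_policy_def)
      have kkt_AE: "AE x in \<mu>. 0 \<le> x \<and> \<nu>.kkt lam x (?r P x)"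
        using \<mu>_nonneg by eventually_elim (simp add: kkt)
      have Q_AE: "AE x in \<mu>. 0 \<le> ?r Q x" using Q(2) by (auto simp: indicator_def)
      have measr: "?r P \<in> borel_measurable borel" "?r Q \<in> borel_measurable borel"
        using meas Q(1) by (simp_all add: set_borel_measurable_def)
      have pw: "(\<integral>\<^sup>+x. ennreal (?r P x) \<partial>\<mu>) = ennreal Pbar" "(\<integral>\<^sup>+x. ennreal (?r Q x) \<partial>\<mu>) \<le> ennreal Pbar"
        using power meas Q(1,3) full by simp_all
      note opt = \<nu>.kkt_policy_optimal[OF \<mu>.real_distribution_axioms measr kkt_AE \<open>0 < lam\<close> Q_AE pw,
          folded objective[OF meas nonneg] objective[OF Q(1,2)]]
      show "secrecy_objective fM fE Q \<le> secrecy_objective fM fE P" by (rule opt(1))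
      assume "secrecy_objective fM fE Q = secrecy_objective fM fE P" "secrecy_objective fM fE P < \<infinity>"
      then have "AE x in \<mu>. ?r Q x = ?r P x" by (rule opt(2))
      then have "AE \<omega> in \<Omega>. ?r Q (hM \<omega>) = ?r P (hM \<omega>)"
        unfolding \<mu>_def by (rule AE_distrD[rotated]) measurable
      then show "AE \<omega> in \<Omega>. Q (hM \<omega>) = P (hM \<omega>)"
        using AE_space by eventually_elim (simp add: assms(3))
    qed
    have "optimal_policy \<Omega> hM fM fE Pbar P"
      unfolding optimal_policy_def is_arg_max_def using feasible best(1) by (auto simp: not_less)
    moreover have "AE \<omega> in \<Omega>. Q (hM \<omega>) = P (hM \<omega>)"
      if "secrecy_objective fM fE P < \<infinity>" "optimal_policy \<Omega> hM fM fE Pbar Q" for Q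
    proof -
      have Q: "feasible_policy \<Omega> hM Pbar Q" "\<not> secrecy_objective fM fE P > secrecy_objective fM fE Q"
        using that(2) feasible by (auto simp: optimal_policy_def is_arg_max_def)
      with best(1)[OF Q(1)] have "secrecy_objective fM fE Q = secrecy_objective fM fE P" by simp
      then show ?thesis using best(2)[OF Q(1)] that(1) by blast
    qed
    ultimately show ?thesis by blast
  qed
  show ?thesis
  proof (intro conjI)
    show "\<forall>lam>0. \<forall>x\<ge>0. (\<exists>p>0. power_equation \<Omega> hE fE lam x p) \<longrightarrow>
        (\<exists>!p. p > 0 \<and> power_equation \<Omega> hE fE lam x p)"
      by (intro allI impI) (rule unique)
    show "\<P>(\<omega> in \<Omega>. hE \<omega> < hM \<omega>) > 0 \<longrightarrow>
        (\<exists>lam>0. \<exists>P. solves_power_equation \<Omega> hE fE lam P \<and>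
           average_power \<Omega> hM P = ennreal Pbar)"
      by (intro impI existence)
  qed (intro allI impI, elim conjE, rule optimal)
qed

end
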